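(* Let $X$ and $Y$ be Hausdorff spaces, let $\tau:X\to X$ be a fixed-point free involution, let $q:X\to X/\tau$ be the quotient map, and let $q^Y:F(Y,2)\to D(Y,2)$ be the quotient double cover. If the triple $\left((X,\tau);Y\right)$ does not satisfy the Borsuk-Ulam property (BUP), then $$\mathrm{secat}(q)\leq \mathrm{secat}(q^Y).$$ Equivalently, if $\mathrm{secat}(q)>\mathrm{secat}(q^Y)$, then the triple $\left((X,\tau);Y\right)$ satisfies the BUP.
   Context: For a Hausdorff space $X$ with a (continuous) fixed-point free involution $\tau:X\to X$ and a Hausdorff space $Y$, the triple $\left((X,\tau);Y\right)$ satisfies the Borsuk-Ulam property (BUP) if for every continuous map $f:X\to Y$ there exists $x\in X$ with $f(\tau(x))=f(x)$. The ordered configuration space is $F(Y,2)=\{(y_1,y_2)\in Y\times Y: y_1\neq y_2\}$ with the subspace topology, with the free involution $\tau_2(y_1,y_2)=(y_2,y_1)$; the unordered configuration space is the quotient $D(Y,2)=F(Y,2)/\tau_2$, and $q^Y:F(Y,2)\to D(Y,2)$ is the quotient map. Both $q$ and $q^Y$ are 2-sheeted covering maps. For a fibration (in particular for such a double cover) $p:E\to B$, the sectional category $\mathrm{secat}(p)$ is the minimal cardinality of an open cover of $B$ such that over each member $U$ there is a continuous local section $s:U\to E$ (i.e. $p\circ s$ is the inclusion $U\hookrightarrow B$); $\mathrm{secat}(p)=\infty$ if no finite such cover exists. (So $\mathrm{secat}(p)=1$ for $B\neq\emptyset$ when $p$ has a global section.) *)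

theory Defs
  imports "HOL-Analysis.Analysis" "HOL-Library.Extended_Nat"
begin

definition free_involution :: "'a topology \<Rightarrow> ('a \<Rightarrow> 'a) \<Rightarrow> bool" where
  "free_involution X \<tau> \<longleftrightarrow>
     continuous_map X X \<tau> \<and> (\<forall>x\<in>topspace X. \<tau> (\<tau> x) = x \<and> \<tau> x \<noteq> x)"

text \<open>The points of \<open>X/\<tau>\<close> are the orbits \<open>{x, \<tau> x}\<close>.\<close>

definition orbit_map :: "('a \<Rightarrow> 'a) \<Rightarrow> 'a \<Rightarrow> 'a set" where
  "orbit_map \<tau> x = {x, \<tau> x}"

definition orbit_space :: "'a topology \<Rightarrow> ('a \<Rightarrow> 'a) \<Rightarrow> 'a set topology" where
  "orbit_space X \<tau> = topology (\<lambda>V. V \<subseteq> orbit_map \<tau> ` topspace X \<and>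
      openin X {x \<in> topspace X. orbit_map \<tau> x \<in> V})"

lemma openin_orbit_space:
  "openin (orbit_space X \<tau>) V \<longleftrightarrow>
     V \<subseteq> orbit_map \<tau> ` topspace X \<and> openin X {x \<in> topspace X. orbit_map \<tau> x \<in> V}"
proof -
  have "istopology (\<lambda>V. V \<subseteq> orbit_map \<tau> ` topspace X \<and>
      openin X {x \<in> topspace X. orbit_map \<tau> x \<in> V})" (is "istopology ?P")
    unfolding istopology_def
  proof (intro conjI allI impI)
    fix S T assume S: "?P S" and T: "?P T"
    show "S \<inter> T \<subseteq> orbit_map \<tau> ` topspace X" using S by blast
    have "{x \<in> topspace X. orbit_map \<tau> x \<in> S \<inter> T} =
        {x \<in> topspace X. orbit_map \<tau> x \<in> S} \<inter> {x \<in> topspace X. orbit_map \<tau> x \<in> T}"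
      by blast
    then show "openin X {x \<in> topspace X. orbit_map \<tau> x \<in> S \<inter> T}"
      using S T by (simp add: openin_Int)
  next
    fix \<K> assume K: "\<forall>K\<in>\<K>. ?P K"
    show "\<Union>\<K> \<subseteq> orbit_map \<tau> ` topspace X" using K by blast
    have "{x \<in> topspace X. orbit_map \<tau> x \<in> \<Union>\<K>} =
        (\<Union>K\<in>\<K>. {x \<in> topspace X. orbit_map \<tau> x \<in> K})"
      by blast
    also have "openin X \<dots>"
      using K by (intro openin_Union) blast
    finally show "openin X {x \<in> topspace X. orbit_map \<tau> x \<in> \<Union>\<K>}" .
  qed
  then show ?thesis
    unfolding orbit_space_def by (simp only: topology_inverse')
qed

lemma topspace_orbit_space: "topspace (orbit_space X \<tau>) = orbit_map \<tau> ` topspace X"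
proof
  show "topspace (orbit_space X \<tau>) \<subseteq> orbit_map \<tau> ` topspace X"
    using openin_topspace[of "orbit_space X \<tau>"] unfolding openin_orbit_space by blast
  have "openin (orbit_space X \<tau>) (orbit_map \<tau> ` topspace X)"
    unfolding openin_orbit_space
    by (simp add: Collect_conj_eq Int_absorb2 subset_iff)
  then show "orbit_map \<tau> ` topspace X \<subseteq> topspace (orbit_space X \<tau>)"
    by (rule openin_subset)
qed

lemma quotient_map_orbit_space: "quotient_map X (orbit_space X \<tau>) (orbit_map \<tau>)"
  unfolding quotient_map_def topspace_orbit_space openin_orbit_space by simp

lemma orbit_map_eq_iff:
  assumes "free_involution X \<tau>" "x \<in> topspace X" "y \<in> topspace X"
  shows "orbit_map \<tau> x = orbit_map \<tau> y \<longleftrightarrow> y = x \<or> y = \<tau> x"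
  using assms unfolding free_involution_def orbit_map_def by (auto simp: doubleton_eq_iff)

definition ordered_config2 :: "'a topology \<Rightarrow> ('a \<times> 'a) topology" where
  "ordered_config2 Y = subtopology (prod_topology Y Y) {(y1, y2). y1 \<noteq> y2}"

abbreviation unordered_config2 :: "'a topology \<Rightarrow> ('a \<times> 'a) set topology" where
  "unordered_config2 Y \<equiv> orbit_space (ordered_config2 Y) prod.swap"

lemma free_involution_swap: "free_involution (ordered_config2 Y) prod.swap"
proof -
  have "continuous_map (prod_topology Y Y) (prod_topology Y Y) (\<lambda>p. (snd p, fst p))"
    by (intro continuous_map_pairedI continuous_map_fst continuous_map_snd)
  then have "continuous_map (prod_topology Y Y) (prod_topology Y Y) prod.swap"
    by (rule continuous_map_eq) (simp add: prod_eq_iff)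
  then show ?thesis
    unfolding free_involution_def ordered_config2_def
    by (auto simp: continuous_map_in_subtopology continuous_map_from_subtopology)
qed

definition borsuk_ulam_property :: "'a topology \<Rightarrow> ('a \<Rightarrow> 'a) \<Rightarrow> 'b topology \<Rightarrow> bool" where
  "borsuk_ulam_property X \<tau> Y \<longleftrightarrow>
     (\<forall>f. continuous_map X Y f \<longrightarrow> (\<exists>x\<in>topspace X. f (\<tau> x) = f x))"

definition has_local_section ::
    "'e topology \<Rightarrow> 'b topology \<Rightarrow> ('e \<Rightarrow> 'b) \<Rightarrow> 'b set \<Rightarrow> bool" where
  "has_local_section E B p U \<longleftrightarrow>
     (\<exists>s. continuous_map (subtopology B U) E s \<and> (\<forall>b\<in>U. p (s b) = b))"

text \<open>The infimum over the empty set is \<open>\<infinity>\<close> in \<^typ>\<open>enat\<close>. The value for an empty base is \<open>0\<close>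
  (empty cover).\<close>

definition secat :: "'e topology \<Rightarrow> 'b topology \<Rightarrow> ('e \<Rightarrow> 'b) \<Rightarrow> enat" where
  "secat E B p = (INF \<U> \<in> {\<U>. finite \<U> \<and> \<Union>\<U> = topspace B \<and>
      (\<forall>U\<in>\<U>. openin B U \<and> has_local_section E B p U)}. enat (card \<U>))"

end

theory Submission
  imports Defs
begin

text \<open>
  If \<open>f\<close> violates the Borsuk--Ulam property, so that \<open>f (\<tau> x) \<noteq> f x\<close> for every \<open>x\<close>, then
  \<open>x \<mapsto> (f x, f (\<tau> x))\<close> is a map \<open>X \<rightarrow> F(Y,2)\<close> that turns \<open>\<tau>\<close> into the swap
  (\<open>equivariant_map_of_not_borsuk_ulam\<close>). The inequality holds for any equivariant map \<open>g\<close> between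
  spaces with free involutions whose target is Hausdorff (\<open>secat_orbit_map_mono\<close>). Indeed \<open>g\<close>
  induces a map of orbit spaces, and an open cover of the target pulls back to one of the source
  with no more members. The local sections pull back as well, because \<open>g\<close> maps each orbit
  bijectively onto an orbit: over an orbit \<open>b\<close>, the pulled-back section picks the one point of
  \<open>b\<close> that \<open>g\<close> sends to the point chosen by the given section over \<open>g ` b\<close>.

  The points picked in this way form a set \<open>W\<close> that meets every orbit over the domain exactly
  once. The Hausdorff property of the target makes \<open>W\<close> open
  (\<open>has_local_section_orbit_map_pullback\<close>), and a choice of representatives from an open set is
  continuous (\<open>has_local_section_orbit_map_slice\<close>).
\<close>

lemma free_involutionD:
  assumes "free_involution X \<tau>"
  shows "continuous_map X X \<tau>"
    and "x \<in> topspace X \<Longrightarrow> \<tau> x \<in> topspace X"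
    and "x \<in> topspace X \<Longrightarrow> \<tau> (\<tau> x) = x"
    and "x \<in> topspace X \<Longrightarrow> \<tau> x \<noteq> x"
    and "x \<in> topspace X \<Longrightarrow> orbit_map \<tau> (\<tau> x) = orbit_map \<tau> x"
  using assms unfolding free_involution_def orbit_map_def
  by (auto dest: continuous_map_image_subset_topspace)

text \<open>The representative in \<open>W\<close> depends continuously on the orbit because the orbit map is open:
  the orbits represented in an open set \<open>Q\<close> are those meeting \<open>W \<inter> Q\<close>, and their union
  is \<open>W \<inter> Q\<close> together with its translate by \<open>\<tau>\<close>.\<close>

lemma has_local_section_orbit_map_slice:
  assumes inv: "free_involution X \<tau>" and W: "openin X W"
    and slice: "\<And>x. x \<in> W \<Longrightarrow> \<tau> x \<notin> W"
  shows "has_local_section X (orbit_space X \<tau>) (orbit_map \<tau>) (orbit_map \<tau> ` W)"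
proof -
  define t where "t b = (THE w. w \<in> W \<and> w \<in> b)" for b
  have WX: "W \<subseteq> topspace X" using W by (rule openin_subset)
  have t: "t (orbit_map \<tau> w) = w" if "w \<in> W" for w
    unfolding t_def orbit_map_def using that slice by (intro the_equality) auto
  have preimage: "openin (orbit_space X \<tau>) {b \<in> orbit_map \<tau> ` W. t b \<in> Q}"
    if Q: "openin X Q" for Q
  proof -
    have "{x \<in> topspace X. orbit_map \<tau> x \<in> {b \<in> orbit_map \<tau> ` W. t b \<in> Q}}
        = (W \<inter> Q) \<union> {x \<in> topspace X. \<tau> x \<in> W \<inter> Q}" (is "?L = ?R")
    proof
      show "?L \<subseteq> ?R"
      proof
        fix x assume "x \<in> ?L"
        then obtain w where x: "x \<in> topspace X" and w: "w \<in> W" "w \<in> Q"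
          and eq: "orbit_map \<tau> x = orbit_map \<tau> w"
          using t by auto
        have "w = x \<or> w = \<tau> x"
          using eq orbit_map_eq_iff[OF inv x] w WX by blast
        then show "x \<in> ?R" using x w by auto
      qed
      show "?R \<subseteq> ?L"
      proof
        fix x assume x: "x \<in> ?R"
        then have "x \<in> topspace X" using WX by auto
        moreover obtain w where "w \<in> W" "w \<in> Q" "orbit_map \<tau> x = orbit_map \<tau> w"
          using x free_involutionD(5)[OF inv] by force
        ultimately show "x \<in> ?L" using t by auto
      qed
    qed
    moreover have "openin X ?R"
      using W Q openin_continuous_map_preimage[OF free_involutionD(1)[OF inv], of "W \<inter> Q"]
      by (intro openin_Un) (auto intro: openin_Int)
    ultimately show ?thesis
      unfolding openin_orbit_space using WX by auto
  qed
  have top: "topspace (subtopology (orbit_space X \<tau>) (orbit_map \<tau> ` W)) = orbit_map \<tau> ` W"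
    using WX by (auto simp: topspace_orbit_space)
  have "continuous_map (subtopology (orbit_space X \<tau>) (orbit_map \<tau> ` W)) X t"
    unfolding continuous_map top
  proof (intro conjI allI impI)
    show "t ` orbit_map \<tau> ` W \<subseteq> topspace X" using t WX by auto
    show "openin (subtopology (orbit_space X \<tau>) (orbit_map \<tau> ` W))
        {b \<in> orbit_map \<tau> ` W. t b \<in> Q}" if "openin X Q" for Q
      using openin_subtopology_Int[OF preimage[OF that], of "orbit_map \<tau> ` W"]
      by (simp add: Int_absorb2 subset_iff)
  qed
  moreover have "\<forall>b\<in>orbit_map \<tau> ` W. orbit_map \<tau> (t b) = b" using t by auto
  ultimately show ?thesis unfolding has_local_section_def by blast
qed

text \<open>On orbit spaces, the map induced by an equivariant map \<open>g\<close> is the image map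
  \<open>b \<mapsto> g ` b\<close>, since an orbit is encoded as the set of its points.\<close>

lemma image_orbit_map:
  assumes "g (\<tau> x) = \<rho> (g x)"
  shows "g ` orbit_map \<tau> x = orbit_map \<rho> (g x)"
  using assms by (simp add: orbit_map_def)

lemma continuous_map_orbit_space_image:
  assumes g: "continuous_map X Z g"
    and equiv: "\<And>x. x \<in> topspace X \<Longrightarrow> g (\<tau> x) = \<rho> (g x)"
  shows "continuous_map (orbit_space X \<tau>) (orbit_space Z \<rho>) (\<lambda>b. g ` b)"
proof -
  have "continuous_map X (orbit_space Z \<rho>) (orbit_map \<rho> \<circ> g)"
    by (rule continuous_map_compose[OF g quotient_imp_continuous_map[OF quotient_map_orbit_space]])
  then have "continuous_map X (orbit_space Z \<rho>) ((\<lambda>b. g ` b) \<circ> orbit_map \<tau>)"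
    by (rule continuous_map_eq) (simp add: image_orbit_map[of g \<tau> _ \<rho>] equiv)
  then show ?thesis
    by (rule continuous_compose_quotient_map[OF quotient_map_orbit_space])
qed

text \<open>Over the preimage of \<open>U\<close>, the set \<open>W\<close> of points \<open>x\<close> with \<open>g x\<close> equal to the point that
  \<open>s\<close> chooses over \<open>g ` {x, \<tau> x}\<close> is a slice. It is defined by an equation, but
  that chosen point is either \<open>g x\<close> or \<open>g (\<tau> x)\<close>, so \<open>W\<close> is also where it differs from
  \<open>g (\<tau> x)\<close>. This second description is an open condition because \<open>Z\<close> is Hausdorff.\<close>

lemma has_local_section_orbit_map_pullback:
  assumes X: "free_involution X \<tau>" and Z: "free_involution Z \<rho>" "Hausdorff_space Z"
    and g: "continuous_map X Z g"
    and equiv: "\<And>x. x \<in> topspace X \<Longrightarrow> g (\<tau> x) = \<rho> (g x)"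
    and U: "openin (orbit_space Z \<rho>) U" "has_local_section Z (orbit_space Z \<rho>) (orbit_map \<rho>) U"
  shows "has_local_section X (orbit_space X \<tau>) (orbit_map \<tau>)
           {b \<in> topspace (orbit_space X \<tau>). g ` b \<in> U}"
proof -
  obtain s where s: "continuous_map (subtopology (orbit_space Z \<rho>) U) Z s"
    and sec: "\<And>b. b \<in> U \<Longrightarrow> orbit_map \<rho> (s b) = b"
    using U(2) unfolding has_local_section_def by blast
  define P where "P = {x \<in> topspace X. g ` orbit_map \<tau> x \<in> U}"
  define \<sigma> where "\<sigma> x = s (g ` orbit_map \<tau> x)" for x
  define W where "W = {x \<in> P. \<sigma> x = g x}"
  have PX: "P \<subseteq> topspace X" by (auto simp: P_def)
  have orbits: "continuous_map X (orbit_space Z \<rho>) (\<lambda>x. g ` orbit_map \<tau> x)"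
    using continuous_map_compose[OF quotient_imp_continuous_map[OF quotient_map_orbit_space]
        continuous_map_orbit_space_image[where \<tau> = \<tau> and \<rho> = \<rho>, OF g equiv]]
    by (simp add: comp_def)
  have P: "openin X P"
    unfolding P_def using orbits U(1) by (rule openin_continuous_map_preimage)
  have \<tau>P: "\<tau> x \<in> P" and \<sigma>\<tau>: "\<sigma> (\<tau> x) = \<sigma> x" if "x \<in> P" for x
    using that free_involutionD(2,5)[OF X] by (auto simp: P_def \<sigma>_def)
  have "continuous_map (subtopology X P) (subtopology (orbit_space Z \<rho>) U)
      (\<lambda>x. g ` orbit_map \<tau> x)"
    unfolding continuous_map_in_subtopology
    using continuous_map_from_subtopology[OF orbits] by (auto simp: P_def)
  then have \<sigma>: "continuous_map (subtopology X P) Z \<sigma>"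
    using continuous_map_compose[OF _ s] by (simp add: comp_def \<sigma>_def[abs_def])
  have choice: "\<sigma> x = g x \<or> \<sigma> x = g (\<tau> x)" if x: "x \<in> P" for x
  proof -
    have xX: "x \<in> topspace X" using x PX by blast
    have "\<sigma> x \<in> topspace Z"
      using continuous_map_image_subset_topspace[OF \<sigma>] x PX by auto
    moreover have "g x \<in> topspace Z"
      using continuous_map_image_subset_topspace[OF g] xX by auto
    moreover have "orbit_map \<rho> (g x) = orbit_map \<rho> (\<sigma> x)"
      using x sec[of "g ` orbit_map \<tau> x"] image_orbit_map[of g \<tau> x \<rho>, OF equiv[OF xX]]
      by (simp add: \<sigma>_def P_def)
    ultimately show ?thesis
      using orbit_map_eq_iff[OF Z(1)] equiv[OF xX] by metis
  qed
  have distinct: "g (\<tau> x) \<noteq> g x" if "x \<in> P" for x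
    using that PX equiv free_involutionD(4)[OF Z(1)] continuous_map_image_subset_topspace[OF g]
    by (metis image_subset_iff subsetD)
  have "continuous_map (subtopology X P) Z (\<lambda>x. g (\<tau> x))"
    using continuous_map_compose[OF free_involutionD(1)[OF X] g]
    by (simp add: comp_def continuous_map_from_subtopology)
  then have "closedin (subtopology X P) {x \<in> topspace (subtopology X P). \<sigma> x = g (\<tau> x)}"
    using \<sigma> Z(2) by (intro closedin_continuous_maps_eq)
  then have "openin (subtopology X P) (P - {x \<in> P. \<sigma> x = g (\<tau> x)})"
    using PX by (simp add: closedin_def Int_absorb1)
  moreover have "P - {x \<in> P. \<sigma> x = g (\<tau> x)} = W"
    using choice distinct unfolding W_def by force
  ultimately have W: "openin X W"
    using P by (simp add: openin_open_subtopology)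
  have slice: "\<tau> x \<notin> W" if "x \<in> W" for x
    using that distinct[of x] \<sigma>\<tau>[of x] by (auto simp: W_def)
  have "{b \<in> topspace (orbit_space X \<tau>). g ` b \<in> U} = orbit_map \<tau> ` P"
    by (auto simp: P_def topspace_orbit_space)
  also have "\<dots> = orbit_map \<tau> ` W"
  proof
    show "orbit_map \<tau> ` P \<subseteq> orbit_map \<tau> ` W"
    proof (rule image_subsetI)
      fix x assume x: "x \<in> P"
      have "x \<in> W \<or> \<tau> x \<in> W"
        using choice[OF x] x \<tau>P[OF x] \<sigma>\<tau>[OF x] by (auto simp: W_def)
      moreover have "orbit_map \<tau> (\<tau> x) = orbit_map \<tau> x"
        using x PX free_involutionD(5)[OF X] by blast
      ultimately show "orbit_map \<tau> x \<in> orbit_map \<tau> ` W" by (metis imageI)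
    qed
  qed (auto simp: W_def)
  finally show ?thesis
    using has_local_section_orbit_map_slice[OF X W slice] by simp
qed

lemma secat_le_pullback:
  assumes h: "continuous_map B C h"
    and sections: "\<And>U. openin C U \<Longrightarrow> has_local_section F C r U \<Longrightarrow>
        has_local_section E B p {b \<in> topspace B. h b \<in> U}"
  shows "secat E B p \<le> secat F C r"
  unfolding secat_def
proof (rule INF_mono)
  fix \<U> assume "\<U> \<in> {\<U>. finite \<U> \<and> \<Union>\<U> = topspace C \<and>
      (\<forall>U\<in>\<U>. openin C U \<and> has_local_section F C r U)}"
  then have fin: "finite \<U>" and cover: "\<Union>\<U> = topspace C"
    and U: "\<And>U. U \<in> \<U> \<Longrightarrow> openin C U" "\<And>U. U \<in> \<U> \<Longrightarrow> has_local_section F C r U"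
    by auto
  define \<V> where "\<V> = (\<lambda>U. {b \<in> topspace B. h b \<in> U}) ` \<U>"
  have "\<Union>\<V> = topspace B"
    using continuous_map_image_subset_topspace[OF h] cover unfolding \<V>_def by blast
  moreover have "\<forall>V\<in>\<V>. openin B V \<and> has_local_section E B p V"
    using U sections openin_continuous_map_preimage[OF h] by (auto simp: \<V>_def)
  moreover have "finite \<V>" "card \<V> \<le> card \<U>"
    using fin by (simp_all add: \<V>_def card_image_le)
  ultimately show "\<exists>\<V>\<in>{\<V>. finite \<V> \<and> \<Union>\<V> = topspace B \<and>
      (\<forall>V\<in>\<V>. openin B V \<and> has_local_section E B p V)}. enat (card \<V>) \<le> enat (card \<U>)"
    by (intro bexI[of _ \<V>]) auto
qed

lemma secat_orbit_map_mono:
  assumes "free_involution X \<tau>" "free_involution Z \<rho>" "Hausdorff_space Z"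
    and "continuous_map X Z g" "\<And>x. x \<in> topspace X \<Longrightarrow> g (\<tau> x) = \<rho> (g x)"
  shows "secat X (orbit_space X \<tau>) (orbit_map \<tau>) \<le> secat Z (orbit_space Z \<rho>) (orbit_map \<rho>)"
  using continuous_map_orbit_space_image[where \<tau> = \<tau> and \<rho> = \<rho>, OF assms(4,5)]
    has_local_section_orbit_map_pullback[OF assms]
  by (rule secat_le_pullback)

lemma Hausdorff_space_ordered_config2:
  "Hausdorff_space Y \<Longrightarrow> Hausdorff_space (ordered_config2 Y)"
  unfolding ordered_config2_def by (simp add: Hausdorff_space_subtopology Hausdorff_space_prod_topology)

lemma equivariant_map_of_not_borsuk_ulam:
  assumes X: "free_involution X \<tau>" and not_bup: "\<not> borsuk_ulam_property X \<tau> Y"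
  obtains g where "continuous_map X (ordered_config2 Y) g"
    and "\<And>x. x \<in> topspace X \<Longrightarrow> g (\<tau> x) = prod.swap (g x)"
proof -
  obtain f where f: "continuous_map X Y f" and ne: "\<And>x. x \<in> topspace X \<Longrightarrow> f (\<tau> x) \<noteq> f x"
    using not_bup unfolding borsuk_ulam_property_def by blast
  have "continuous_map X Y (\<lambda>x. f (\<tau> x))"
    using continuous_map_compose[OF free_involutionD(1)[OF X] f] by (simp add: comp_def)
  then have "continuous_map X (ordered_config2 Y) (\<lambda>x. (f x, f (\<tau> x)))"
    unfolding ordered_config2_def continuous_map_in_subtopology
    using f ne by (force intro: continuous_map_pairedI)
  then show thesis
    using free_involutionD(3)[OF X] by (intro that[of "\<lambda>x. (f x, f (\<tau> x))"]) auto
qed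

theorem theorem3p14:
  fixes X :: "'a topology" and Y :: "'b topology" and \<tau> :: "'a \<Rightarrow> 'a"
  assumes "Hausdorff_space X" and "Hausdorff_space Y"
    and "free_involution X \<tau>"
  shows "(\<not> borsuk_ulam_property X \<tau> Y \<longrightarrow>
            secat X (orbit_space X \<tau>) (orbit_map \<tau>)
              \<le> secat (ordered_config2 Y) (unordered_config2 Y) (orbit_map prod.swap))
       \<and> (secat X (orbit_space X \<tau>) (orbit_map \<tau>)
              > secat (ordered_config2 Y) (unordered_config2 Y) (orbit_map prod.swap) \<longrightarrow>
            borsuk_ulam_property X \<tau> Y)"
proof -
  have "secat X (orbit_space X \<tau>) (orbit_map \<tau>)
      \<le> secat (ordered_config2 Y) (unordered_config2 Y) (orbit_map prod.swap)"
    if not_bup: "\<not> borsuk_ulam_property X \<tau> Y"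
  proof -
    obtain g where "continuous_map X (ordered_config2 Y) g"
      and "\<And>x. x \<in> topspace X \<Longrightarrow> g (\<tau> x) = prod.swap (g x)"
      using equivariant_map_of_not_borsuk_ulam[OF assms(3) not_bup] by blast
    then show ?thesis
      using secat_orbit_map_mono[OF assms(3) free_involution_swap
          Hausdorff_space_ordered_config2[OF assms(2)]] by blast
  qed
  then show ?thesis by (auto simp: not_le[symmetric])
qed

end
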